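(* For every integer $n\geq 0$, $$F_{4n+1}=s_1\sum_{i=0}^n\binom{2n-i}{i}(-s_3)^i(s_1s_2)^{n-i}-s_2\sum_{i=0}^{n-1}\binom{2n-1-i}{i}(-s_3)^is_1^{n-1-i}s_2^{n-i},$$ $$F_{4n+3}=s_1\sum_{i=0}^n\binom{2n+1-i}{i}(-s_3)^is_1^{n+1-i}s_2^{n-i}-s_2\sum_{i=0}^{n}\binom{2n-i}{i}(-s_3)^i(s_1s_2)^{n-i}.$$
   Context: The odd $*$-Fibonacci polynomials $F_{2n+1}\in\mathbb Z[s_1,s_2,s_3]$, $n\ge0$, are defined by $F_1=s_1$, $F_3=s_1^2-s_2$, and $F_{2n+3}=g_nF_{2n+1}-s_3F_{2n-1}$ for $n\ge1$, where $g_n=s_2$ if $n$ is odd and $g_n=s_1$ if $n$ is even. Equivalently $F_{4n+3}=s_1F_{4n+1}-s_3F_{4n-1}$ and $F_{4n+5}=s_2F_{4n+3}-s_3F_{4n+1}$. Empty sums are zero. *)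

theory Defs
  imports Main "HOL-Library.Poly_Mapping" "HOL-Library.Numeral_Type"
begin

text \<open>
  The ring of integer polynomials in three variables: finitely supported maps from exponent
  vectors to coefficients, with convolution as multiplication. The variables are indexed by the
  three-element type \<open>3\<close>, in which the numeral \<open>3\<close> denotes \<open>0\<close>; hence \<open>1\<close>, \<open>2\<close>, \<open>3\<close> are distinct.
\<close>

type_synonym int_poly3 = "(3 \<Rightarrow>\<^sub>0 nat) \<Rightarrow>\<^sub>0 int"

definition var :: "3 \<Rightarrow> int_poly3" where
  "var j = Poly_Mapping.single (Poly_Mapping.single j 1) 1"

abbreviation s1 :: int_poly3 where "s1 \<equiv> var 1"
abbreviation s2 :: int_poly3 where "s2 \<equiv> var 2"
abbreviation s3 :: int_poly3 where "s3 \<equiv> var 3"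

definition g :: "nat \<Rightarrow> int_poly3" where
  "g n = (if odd n then s2 else s1)"

text \<open>
  \<open>odd_star_fib n\<close> is the odd $*$-Fibonacci polynomial $F_{2n+1}$. Since only odd subscripts occur,
  the position \<open>n\<close> is used as the index; thus $F_{4n+1}$ is \<open>odd_star_fib (2 * n)\<close> and
  $F_{4n+3}$ is \<open>odd_star_fib (2 * n + 1)\<close>. The last equation is
  $F_{2m+3} = g_m F_{2m+1} - s_3 F_{2m-1}$ for $m = n + 1 \ge 1$.
\<close>

fun odd_star_fib :: "nat \<Rightarrow> int_poly3" where
  "odd_star_fib 0 = s1"
| "odd_star_fib (Suc 0) = s1 ^ 2 - s2"
| "odd_star_fib (Suc (Suc n)) = g (Suc n) * odd_star_fib (Suc n) - s3 * odd_star_fib n"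

end

theory Submission imports Defs begin

text \<open>
  The recurrence multiplies alternately by \<open>s2\<close> and \<open>s1\<close>, so over two steps it depends only on
  \<open>p = s1 * s2\<close> and \<open>z = - s3\<close>; the two variables occur separately only through the initial values
  and the parity of the position. Write \<open>E\<^sub>n = \<Sum>\<^sub>i (2n-i choose i) z^i p^(n-i)\<close> and \<open>O\<^sub>n = \<Sum>\<^sub>i (2n+1-i choose i) z^i p^(n-i)\<close>.
  Both are diagonal sums of Pascal's triangle, and Pascal's rule gives the Fibonacci-type recurrences
  \<open>E\<^sub>n\<^sub>+\<^sub>1 = p O\<^sub>n + z E\<^sub>n\<close> and \<open>O\<^sub>n\<^sub>+\<^sub>1 = E\<^sub>n\<^sub>+\<^sub>1 + z O\<^sub>n\<close>.

  In these terms the claim is \<open>F\<^sub>4\<^sub>n\<^sub>+\<^sub>1 = s1 E\<^sub>n - s2^2 O\<^sub>n\<^sub>-\<^sub>1\<close> and \<open>F\<^sub>4\<^sub>n\<^sub>+\<^sub>3 = s1^2 O\<^sub>n - s2 E\<^sub>n\<close>,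
  with \<open>O\<^sub>-\<^sub>1 = 0\<close>. It follows by induction: for instance
  \<open>s2 F\<^sub>4\<^sub>n\<^sub>+\<^sub>3 + z F\<^sub>4\<^sub>n\<^sub>+\<^sub>1 = s1 (p O\<^sub>n + z E\<^sub>n) - s2^2 (E\<^sub>n + z O\<^sub>n\<^sub>-\<^sub>1) = s1 E\<^sub>n\<^sub>+\<^sub>1 - s2^2 O\<^sub>n\<close>.
\<close>

text \<open>
  The length \<open>k\<close> of the sum is kept independent of the diagonal \<open>m\<close>, so that a single instance of
  Pascal's rule serves both parities of \<open>m\<close>.
\<close>
definition diagonal_sum :: "nat \<Rightarrow> nat \<Rightarrow> 'a::comm_ring_1 \<Rightarrow> 'a \<Rightarrow> 'a" where
  "diagonal_sum m k z p = (\<Sum>i = 0..k. of_nat ((m - i) choose i) * z ^ i * p ^ (k - i))"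

text \<open>
  Pascal's rule in every term with \<open>i > 0\<close>; the bound on \<open>k\<close> keeps the truncated subtraction
  \<open>m - i\<close> honest.
\<close>
lemma diagonal_sum_pascal:
  assumes "k \<le> m"
  shows "diagonal_sum (m + 2) (Suc k) z p
         = diagonal_sum (Suc m) (Suc k) z p + z * diagonal_sum m k z p"
proof -
  have pascal: "(m + 2 - Suc i) choose Suc i = ((Suc m - Suc i) choose Suc i) + ((m - i) choose i)"
    if "i \<le> k" for i
  proof -
    have "m + 2 - Suc i = Suc (m - i)"
      using that assms by simp
    then show ?thesis by simp
  qed
  have "(\<Sum>i = 0..k. of_nat ((m + 2 - Suc i) choose Suc i) * z ^ Suc i * p ^ (Suc k - Suc i))
      = (\<Sum>i = 0..k. of_nat ((Suc m - Suc i) choose Suc i) * z ^ Suc i * p ^ (Suc k - Suc i)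
           + z * (of_nat ((m - i) choose i) * z ^ i * p ^ (k - i)))"
    by (intro sum.cong refl, subst pascal) (simp_all add: algebra_simps)
  then show ?thesis
    unfolding diagonal_sum_def
    by (simp only: sum.atLeast0_atMost_Suc_shift comp_def sum.distrib sum_distrib_left)
       simp
qed

text \<open>
  One index beyond the diagonal contributes nothing, as \<open>k choose (k + 1) = 0\<close>: an odd diagonal may
  be summed one step too far at the price of a factor \<open>p\<close>.
\<close>
lemma diagonal_sum_odd_extend:
  "diagonal_sum (Suc (2 * k)) (Suc k) z p = p * diagonal_sum (Suc (2 * k)) k z p"
proof -
  have "(\<Sum>i = 0..k. of_nat ((Suc (2 * k) - i) choose i) * z ^ i * p ^ (Suc k - i))
      = (\<Sum>i = 0..k. p * (of_nat ((Suc (2 * k) - i) choose i) * z ^ i * p ^ (k - i)))"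
    by (intro sum.cong refl) (simp add: Suc_diff_le ac_simps)
  then show ?thesis
    by (simp add: diagonal_sum_def sum_distrib_left binomial_eq_0)
qed

lemma diagonal_sum_even_rec:
  "diagonal_sum (2 * Suc k) (Suc k) z p
   = p * diagonal_sum (Suc (2 * k)) k z p + z * diagonal_sum (2 * k) k z p"
  using diagonal_sum_pascal[of k "2 * k" z p] by (simp add: diagonal_sum_odd_extend)

lemma diagonal_sum_odd_rec:
  "diagonal_sum (Suc (2 * Suc k)) (Suc k) z p
   = diagonal_sum (2 * Suc k) (Suc k) z p + z * diagonal_sum (Suc (2 * k)) k z p"
  using diagonal_sum_pascal[of k "Suc (2 * k)" z p] by simp

lemma odd_star_fib_even_step:
  "odd_star_fib (2 * Suc n) = s2 * odd_star_fib (Suc (2 * n)) - s3 * odd_star_fib (2 * n)"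
  by (simp add: g_def)

lemma odd_star_fib_odd_step:
  "odd_star_fib (Suc (2 * Suc n)) = s1 * odd_star_fib (2 * Suc n) - s3 * odd_star_fib (Suc (2 * n))"
proof -
  have "odd_star_fib (Suc (Suc (Suc (2 * n))))
      = g (Suc (Suc (2 * n))) * odd_star_fib (Suc (Suc (2 * n))) - s3 * odd_star_fib (Suc (2 * n))"
    by (rule odd_star_fib.simps)
  then show ?thesis
    by (simp add: g_def del: odd_star_fib.simps)
qed

text \<open>
  The induction starts one step late in \<open>F\<^sub>4\<^sub>n\<^sub>+\<^sub>1\<close>: stating that formula for \<open>F\<^sub>4\<^sub>n\<^sub>+\<^sub>5\<close> avoids
  the sum with index \<open>-1\<close>.
\<close>
lemma odd_star_fib_diagonal_sum:
  defines "z \<equiv> - s3" and "p \<equiv> s1 * s2"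
  shows "odd_star_fib (2 * Suc n)
           = s1 * diagonal_sum (2 * Suc n) (Suc n) z p - s2 ^ 2 * diagonal_sum (Suc (2 * n)) n z p
       \<and> odd_star_fib (Suc (2 * n))
           = s1 ^ 2 * diagonal_sum (Suc (2 * n)) n z p - s2 * diagonal_sum (2 * n) n z p"
proof (induction n)
  case 0
  show ?case
    by (simp add: diagonal_sum_def g_def z_def p_def algebra_simps power2_eq_square)
next
  case (Suc n)
  note even = conjunct1[OF Suc.IH] and odd = conjunct2[OF Suc.IH]
  have odd': "odd_star_fib (Suc (2 * Suc n))
      = s1 ^ 2 * diagonal_sum (Suc (2 * Suc n)) (Suc n) z p
        - s2 * diagonal_sum (2 * Suc n) (Suc n) z p"
    unfolding odd_star_fib_odd_step even odd diagonal_sum_odd_rec diagonal_sum_even_rec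
    by (simp add: z_def p_def algebra_simps power2_eq_square)
  have "odd_star_fib (2 * Suc (Suc n))
      = s1 * diagonal_sum (2 * Suc (Suc n)) (Suc (Suc n)) z p
        - s2 ^ 2 * diagonal_sum (Suc (2 * Suc n)) (Suc n) z p"
    unfolding odd_star_fib_even_step[of "Suc n"] odd' even
      diagonal_sum_even_rec[of "Suc n"] diagonal_sum_odd_rec
    by (simp add: z_def p_def algebra_simps power2_eq_square)
  with odd' show ?case by blast
qed

text \<open>
  What remains is to collect the unequal powers of \<open>s1\<close> and \<open>s2\<close> into powers of \<open>s1 * s2\<close>.
\<close>
lemma sum_extra_s1:
  fixes z x y :: "'a::comm_ring_1"
  shows "(\<Sum>i = 0..n. of_nat ((2 * n + 1 - i) choose i) * z ^ i * x ^ (n + 1 - i) * y ^ (n - i))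
         = x * diagonal_sum (Suc (2 * n)) n z (x * y)"
  unfolding diagonal_sum_def sum_distrib_left
  by (intro sum.cong refl) (simp add: Suc_diff_le power_mult_distrib ac_simps)

lemma sum_extra_s2:
  fixes z x y :: "'a::comm_ring_1"
  shows "(\<Sum>i = 0..<Suc n. of_nat ((2 * Suc n - 1 - i) choose i) * z ^ i * x ^ (Suc n - 1 - i)
            * y ^ (Suc n - i))
         = y * diagonal_sum (Suc (2 * n)) n z (x * y)"
  unfolding diagonal_sum_def sum_distrib_left atLeastLessThanSuc_atLeastAtMost
  by (intro sum.cong refl) (simp add: Suc_diff_le power_mult_distrib ac_simps)

theorem theorem8p5:
  fixes n :: nat
  shows "odd_star_fib (2 * n) =
           s1 * (\<Sum>i = 0..n. of_nat ((2 * n - i) choose i) * (- s3) ^ i * (s1 * s2) ^ (n - i))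
         - s2 * (\<Sum>i = 0..<n. of_nat ((2 * n - 1 - i) choose i) * (- s3) ^ i * s1 ^ (n - 1 - i) * s2 ^ (n - i))
       \<and> odd_star_fib (2 * n + 1) =
           s1 * (\<Sum>i = 0..n. of_nat ((2 * n + 1 - i) choose i) * (- s3) ^ i * s1 ^ (n + 1 - i) * s2 ^ (n - i))
         - s2 * (\<Sum>i = 0..n. of_nat ((2 * n - i) choose i) * (- s3) ^ i * (s1 * s2) ^ (n - i))"
proof (intro conjI)
  show "odd_star_fib (2 * n) =
           s1 * (\<Sum>i = 0..n. of_nat ((2 * n - i) choose i) * (- s3) ^ i * (s1 * s2) ^ (n - i))
         - s2 * (\<Sum>i = 0..<n. of_nat ((2 * n - 1 - i) choose i) * (- s3) ^ i * s1 ^ (n - 1 - i) * s2 ^ (n - i))"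
  proof (cases n)
    case 0
    then show ?thesis by simp
  next
    case (Suc m)
    show ?thesis
      unfolding Suc sum_extra_s2 diagonal_sum_def[symmetric]
        conjunct1[OF odd_star_fib_diagonal_sum]
      by (simp add: power2_eq_square mult.assoc)
  qed
next
  show "odd_star_fib (2 * n + 1) =
           s1 * (\<Sum>i = 0..n. of_nat ((2 * n + 1 - i) choose i) * (- s3) ^ i * s1 ^ (n + 1 - i) * s2 ^ (n - i))
         - s2 * (\<Sum>i = 0..n. of_nat ((2 * n - i) choose i) * (- s3) ^ i * (s1 * s2) ^ (n - i))"
    unfolding sum_extra_s1
    unfolding diagonal_sum_def[symmetric] Suc_eq_plus1[symmetric]
      conjunct2[OF odd_star_fib_diagonal_sum]
    by (simp add: power2_eq_square mult.assoc)
qed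

end
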